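(* Let $G$ be a finite group acting on a finite nonempty set $X$, let $K$ be the classical Burnside kernel on $X$ and $Q$ the dual Burnside kernel on $G^*$. Then all eigenvalues of $K$ and $Q$ are real and nonnegative. Hence $$\lambda_*(K)=\lambda_1(K)=\lambda_1(Q)=\lambda_*(Q).$$ Consequently, $$\mathrm{gap}(K)=\mathrm{gap}(Q),\qquad t_{\mathrm{rel}}(K)=t_{\mathrm{rel}}(Q).$$
   Context: For $g\in G$ and $x\in X$ write $X_g:=\{x\in X: g\cdot x=x\}$, $G_x:=\{g\in G: g\cdot x=x\}$, and $G^*:=\{g\in G: X_g\neq\varnothing\}$. The classical Burnside kernel is the $X\times X$ matrix $$K(x,y)=\frac1{|G_x|}\sum_{g\in G_x\cap G_y}\frac1{|X_g|},$$ and the dual Burnside kernel is the $G^*\times G^*$ matrix $$Q(g,h)=\frac1{|X_g|}\sum_{x\in X_g\cap X_h}\frac1{|G_x|}.$$ Both are irreducible reversible stochastic matrices. For an irreducible reversible kernel $P$ set $$\lambda_1(P):=\max\{\lambda\in\mathrm{Spec}(P):\lambda\neq1\},\qquad \lambda_*(P):=\max\{|\lambda|:\lambda\in\mathrm{Spec}(P),\ \lambda\neq1\},$$ with $\lambda_1(P)=\lambda_*(P)=0$ if there is no eigenvalue other than $1$; and $\mathrm{gap}(P):=1-\lambda_*(P)$, $t_{\mathrm{rel}}(P):=\mathrm{gap}(P)^{-1}$. *)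

theory Defs
  imports Complex_Main "HOL-Algebra.Group_Action" "Jordan_Normal_Form.Spectral_Radius"
begin

text \<open>
  Matrices with rows and columns indexed by a finite set \<open>S\<close> are functions
  \<open>P :: 'a \<Rightarrow> 'a \<Rightarrow> real\<close> together with \<open>S\<close>; the values of \<open>P\<close> outside \<open>S \<times> S\<close> are irrelevant.
  The spectrum is taken over the complex numbers, so that the reality of all eigenvalues has
  content. The lemma \<open>Spec_eq_spectrum\<close> below compares it with the library notion.
\<close>

definition Spec :: "'a set \<Rightarrow> ('a \<Rightarrow> 'a \<Rightarrow> real) \<Rightarrow> complex set" where
  "Spec S P = {\<mu>. \<exists>v :: 'a \<Rightarrow> complex.
      (\<exists>x\<in>S. v x \<noteq> 0) \<and>
      (\<forall>x\<in>S. (\<Sum>y\<in>S. complex_of_real (P x y) * v y) = \<mu> * v x)}"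

lemma Spec_eq_spectrum:
  assumes e: "bij_betw e {..<n} S"
  shows "Spec S P = spectrum (mat n n (\<lambda>(i, j). complex_of_real (P (e i) (e j))))"
    (is "_ = spectrum ?A")
proof -
  have row: "(?A *\<^sub>v w) $ i = (\<Sum>y\<in>S. complex_of_real (P (e i) y) * v y)"
    if "i < n" "w \<in> carrier_vec n" "\<And>j. j < n \<Longrightarrow> w $ j = v (e j)" for w v i
  proof -
    have "(?A *\<^sub>v w) $ i = (\<Sum>j<n. complex_of_real (P (e i) (e j)) * v (e j))"
      using that by (simp add: scalar_prod_def lessThan_atLeast0)
    also have "\<dots> = (\<Sum>y\<in>S. complex_of_real (P (e i) y) * v y)"
      by (rule sum.reindex_bij_betw[OF e])
    finally show ?thesis .
  qed
  have S: "S = e ` {..<n}" and inj: "inj_on e {..<n}"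
    using e by (auto simp: bij_betw_def)
  show ?thesis
  proof (intro Set.set_eqI iffI)
    fix l assume "l \<in> Spec S P"
    then obtain v where v: "\<exists>x\<in>S. v x \<noteq> 0"
      "\<And>x. x \<in> S \<Longrightarrow> (\<Sum>y\<in>S. complex_of_real (P x y) * v y) = l * v x"
      by (auto simp: Spec_def)
    define w where "w = vec n (\<lambda>i. v (e i))"
    have w: "w \<in> carrier_vec n" "\<And>j. j < n \<Longrightarrow> w $ j = v (e j)"
      by (auto simp: w_def)
    have "w \<noteq> 0\<^sub>v n"
    proof
      assume "w = 0\<^sub>v n"
      then have "v (e j) = 0" if "j < n" for j
        using w(2)[OF that] that by simp
      with v(1) S show False by auto
    qed
    moreover have "?A *\<^sub>v w = l \<cdot>\<^sub>v w"
    proof (rule eq_vecI)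
      fix i assume "i < dim_vec (l \<cdot>\<^sub>v w)"
      then have i: "i < n" using w by simp
      then have "(?A *\<^sub>v w) $ i = (\<Sum>y\<in>S. complex_of_real (P (e i) y) * v y)"
        using w by (intro row) auto
      also have "\<dots> = l * v (e i)"
        using i S by (intro v(2)) auto
      finally show "(?A *\<^sub>v w) $ i = (l \<cdot>\<^sub>v w) $ i"
        using w i by simp
    qed (use w in simp)
    ultimately show "l \<in> spectrum ?A"
      using w by (auto simp: spectrum_def eigenvalue_def eigenvector_def)
  next
    fix l assume "l \<in> spectrum ?A"
    then obtain w where w: "w \<in> carrier_vec n" "w \<noteq> 0\<^sub>v n" "?A *\<^sub>v w = l \<cdot>\<^sub>v w"
      by (auto simp: spectrum_def eigenvalue_def eigenvector_def)
    define v where "v = (\<lambda>x. w $ the_inv_into {..<n} e x)"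
    have vw: "w $ j = v (e j)" if "j < n" for j
      using that inj by (simp add: v_def the_inv_into_f_f)
    have "\<exists>j<n. w $ j \<noteq> 0"
      using w(1,2) by (metis carrier_vecD eq_vecI index_zero_vec)
    then have "\<exists>x\<in>S. v x \<noteq> 0"
      using vw S by auto
    moreover have "(\<Sum>y\<in>S. complex_of_real (P x y) * v y) = l * v x" if "x \<in> S" for x
    proof -
      from that S obtain i where i: "i < n" "x = e i" by auto
      have "(\<Sum>y\<in>S. complex_of_real (P (e i) y) * v y) = (?A *\<^sub>v w) $ i"
        using row[OF i(1) w(1) vw] by simp
      also have "\<dots> = l * v (e i)"
        using w i vw by simp
      finally show ?thesis by (simp add: i)
    qed
    ultimately show "l \<in> Spec S P"
      by (auto simp: Spec_def)
  qed
qed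

text \<open>
  The quantities below are meant for irreducible reversible kernels, whose spectrum is real;
  \<open>Re\<close> in \<open>lambda_1\<close> then only changes the type.
\<close>

definition lambda_1 :: "'a set \<Rightarrow> ('a \<Rightarrow> 'a \<Rightarrow> real) \<Rightarrow> real" where
  "lambda_1 S P = (if Spec S P - {1} = {} then 0 else Max (Re ` (Spec S P - {1})))"

definition lambda_star :: "'a set \<Rightarrow> ('a \<Rightarrow> 'a \<Rightarrow> real) \<Rightarrow> real" where
  "lambda_star S P = (if Spec S P - {1} = {} then 0 else Max (cmod ` (Spec S P - {1})))"

definition gap :: "'a set \<Rightarrow> ('a \<Rightarrow> 'a \<Rightarrow> real) \<Rightarrow> real" where
  "gap S P = 1 - lambda_star S P"

definition t_rel :: "'a set \<Rightarrow> ('a \<Rightarrow> 'a \<Rightarrow> real) \<Rightarrow> real" where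
  "t_rel S P = inverse (gap S P)"

text \<open>
  For an action \<open>\<phi>\<close> of \<open>G\<close> on \<open>X\<close>, the stabilizer \<open>G\<^sub>x\<close> is \<open>stabilizer G \<phi> x\<close> and the fixed-point
  set \<open>X\<^sub>g\<close> is \<open>invariants X \<phi> g\<close>.
\<close>

definition G_star :: "('g, 'm) monoid_scheme \<Rightarrow> 'x set \<Rightarrow> ('g \<Rightarrow> 'x \<Rightarrow> 'x) \<Rightarrow> 'g set" where
  "G_star G X \<phi> = {g \<in> carrier G. invariants X \<phi> g \<noteq> {}}"

definition burnside_kernel ::
  "('g, 'm) monoid_scheme \<Rightarrow> 'x set \<Rightarrow> ('g \<Rightarrow> 'x \<Rightarrow> 'x) \<Rightarrow> 'x \<Rightarrow> 'x \<Rightarrow> real" where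
  "burnside_kernel G X \<phi> x y =
     1 / real (card (stabilizer G \<phi> x)) *
     (\<Sum>g \<in> stabilizer G \<phi> x \<inter> stabilizer G \<phi> y. 1 / real (card (invariants X \<phi> g)))"

definition dual_burnside_kernel ::
  "('g, 'm) monoid_scheme \<Rightarrow> 'x set \<Rightarrow> ('g \<Rightarrow> 'x \<Rightarrow> 'x) \<Rightarrow> 'g \<Rightarrow> 'g \<Rightarrow> real" where
  "dual_burnside_kernel G X \<phi> g h =
     1 / real (card (invariants X \<phi> g)) *
     (\<Sum>x \<in> invariants X \<phi> g \<inter> invariants X \<phi> h. 1 / real (card (stabilizer G \<phi> x)))"

end

theory Submission
  imports Defs
begin

text \<open>
  With \<open>M x g = 1\<close> if \<open>g\<close> fixes \<open>x\<close> and \<open>M x g = 0\<close> otherwise, both kernels are products of a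
  positive diagonal matrix with a Gram matrix: \<open>K = D\<^sub>a M D\<^sub>b M\<^sup>T\<close> and \<open>Q = D\<^sub>b M\<^sup>T D\<^sub>a M\<close>, where
  \<open>a x = 1 / |G\<^sub>x|\<close> and \<open>b g = 1 / |X\<^sub>g|\<close>. So both are self-adjoint and positive semidefinite for
  suitable weighted inner products, and they have the form \<open>A B\<close> and \<open>B A\<close>, hence the same
  nonzero spectrum. The eigenvalue \<open>0\<close>, which may occur for only one of them, does not change the
  maximum because \<open>\<lambda>\<^sub>1\<close> and \<open>\<lambda>\<^sub>*\<close> are \<open>0\<close> by convention if no eigenvalue other than \<open>1\<close> exists.
\<close>

definition gram_kernel ::
  "'b set \<Rightarrow> ('a \<Rightarrow> real) \<Rightarrow> ('b \<Rightarrow> real) \<Rightarrow> ('a \<Rightarrow> 'b \<Rightarrow> real) \<Rightarrow> 'a \<Rightarrow> 'a \<Rightarrow> real" where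
  "gram_kernel T a b M x y = a x * (\<Sum>g\<in>T. M x g * b g * M y g)"

text \<open>Regroups the product as \<open>A (B v)\<close>: the inner sum is
  \<open>M\<^sup>T v\<close>, from which the quadratic form and the swap to \<open>B A\<close> can
  both be read off.\<close>

lemma gram_kernel_mult:
  fixes v :: "'a \<Rightarrow> complex"
  shows "(\<Sum>y\<in>S. of_real (gram_kernel T a b M x y) * v y) =
    of_real (a x) * (\<Sum>g\<in>T. of_real (M x g) * (of_real (b g) * (\<Sum>y\<in>S. of_real (M y g) * v y)))"
proof -
  have "(\<Sum>y\<in>S. of_real (gram_kernel T a b M x y) * v y) =
      (\<Sum>y\<in>S. \<Sum>g\<in>T. of_real (a x) * (of_real (M x g) * (of_real (b g) * (of_real (M y g) * v y))))"
    by (simp add: gram_kernel_def sum_distrib_left sum_distrib_right mult_ac)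
  also have "\<dots> = (\<Sum>g\<in>T. \<Sum>y\<in>S. of_real (a x) * (of_real (M x g) * (of_real (b g) * (of_real (M y g) * v y))))"
    by (rule sum.swap)
  finally show ?thesis
    by (simp add: sum_distrib_left)
qed

text \<open>Pairing the eigenvector equation with \<open>v\<close> in the inner product with weights
  \<open>1 / a x\<close> gives \<open>\<mu> * N = E\<close>, where \<open>N > 0\<close> is the
  weighted squared norm of \<open>v\<close> and \<open>E \<ge> 0\<close> is a
  \<open>b\<close>-weighted sum of squares of \<open>M\<^sup>T v\<close>.\<close>

lemma Spec_gram_kernel_nonneg:
  assumes "finite S" and a: "\<And>x. x \<in> S \<Longrightarrow> a x > 0" and b: "\<And>g. g \<in> T \<Longrightarrow> b g \<ge> 0"
    and "\<mu> \<in> Spec S (gram_kernel T a b M)"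
  shows "\<mu> \<in> \<real>" "Re \<mu> \<ge> 0"
proof -
  obtain v where v0: "\<exists>x\<in>S. v x \<noteq> 0"
    and v: "\<And>x. x \<in> S \<Longrightarrow> (\<Sum>y\<in>S. of_real (gram_kernel T a b M x y) * v y) = \<mu> * v x"
    using assms(4) by (auto simp: Spec_def)
  define s where "s g = (\<Sum>y\<in>S. of_real (M y g) * v y)" for g
  define N where "N = (\<Sum>x\<in>S. (cmod (v x))\<^sup>2 / a x)"
  define E where "E = (\<Sum>g\<in>T. b g * (cmod (s g))\<^sup>2)"
  obtain z where z: "z \<in> S" "v z \<noteq> 0"
    using v0 by blast
  have "N > 0"
    unfolding N_def using \<open>finite S\<close> z a by (intro sum_pos2[of _ z]) (auto simp: less_imp_le)
  have "E \<ge> 0"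
    unfolding E_def using b by (intro sum_nonneg) auto
  \<comment> \<open>Dividing by \<open>a x\<close> removes the left diagonal factor and leaves the
    entries of \<open>M D\<^sub>b M\<^sup>T v\<close>.\<close>
  have row: "\<mu> * v x / of_real (a x) = (\<Sum>g\<in>T. of_real (M x g) * (of_real (b g) * s g))"
    if "x \<in> S" for x
    using v[OF that] a[OF that] unfolding gram_kernel_mult s_def by (auto simp: field_simps)
  have "\<mu> * of_real N = (\<Sum>x\<in>S. cnj (v x) * (\<mu> * v x / of_real (a x)))"
    unfolding N_def of_real_sum sum_distrib_left
    by (intro sum.cong) (simp_all add: complex_norm_square of_real_divide mult_ac flip: of_real_power)
  also have "\<dots> = (\<Sum>x\<in>S. cnj (v x) * (\<Sum>g\<in>T. of_real (M x g) * (of_real (b g) * s g)))"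
    by (intro sum.cong refl) (simp only: row)
  \<comment> \<open>\<open>M x g\<close> is real, so it may move under \<open>cnj\<close>; once the
    sums are exchanged, the sum over \<open>x\<close> collapses to \<open>cnj (s g)\<close>.\<close>
  also have "\<dots> = (\<Sum>x\<in>S. \<Sum>g\<in>T. of_real (b g) * (s g * cnj (of_real (M x g) * v x)))"
    by (simp add: sum_distrib_left mult_ac)
  also have "\<dots> = (\<Sum>g\<in>T. \<Sum>x\<in>S. of_real (b g) * (s g * cnj (of_real (M x g) * v x)))"
    by (rule sum.swap)
  also have "\<dots> = (\<Sum>g\<in>T. of_real (b g) * (s g * cnj (s g)))"
    by (simp only: sum_distrib_left[symmetric] cnj_sum[symmetric] s_def)
  also have "\<dots> = of_real E"
    unfolding E_def of_real_sum of_real_mult complex_norm_square ..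
  finally have "\<mu> = of_real (E / N)"
    using \<open>N > 0\<close> by (simp add: field_simps)
  then show "\<mu> \<in> \<real>" "Re \<mu> \<ge> 0"
    using \<open>N > 0\<close> \<open>E \<ge> 0\<close> by auto
qed

text \<open>If \<open>A B v = \<mu> v\<close> with \<open>\<mu> \<noteq> 0\<close>, then \<open>w = B v\<close> is nonzero and \<open>B A w = \<mu> w\<close>.\<close>

lemma Spec_gram_kernel_transpose_subset:
  "Spec S (gram_kernel T a b M) - {0} \<subseteq> Spec T (gram_kernel S b a (\<lambda>g x. M x g))"
proof
  fix \<mu> assume "\<mu> \<in> Spec S (gram_kernel T a b M) - {0}"
  then obtain v where "\<mu> \<noteq> 0" and v0: "\<exists>x\<in>S. v x \<noteq> 0"
    and v: "\<And>x. x \<in> S \<Longrightarrow> (\<Sum>y\<in>S. of_real (gram_kernel T a b M x y) * v y) = \<mu> * v x"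
    by (auto simp: Spec_def)
  define w where "w g = of_real (b g) * (\<Sum>y\<in>S. of_real (M y g) * v y)" for g
  have Aw: "of_real (a x) * (\<Sum>g\<in>T. of_real (M x g) * w g) = \<mu> * v x" if "x \<in> S" for x
    using v[OF that] by (simp add: gram_kernel_mult w_def)
  have "\<exists>g\<in>T. w g \<noteq> 0"
  proof (rule ccontr)
    assume "\<not> (\<exists>g\<in>T. w g \<noteq> 0)"
    then have "\<mu> * v x = 0" if "x \<in> S" for x
      using Aw[OF that] by simp
    with v0 \<open>\<mu> \<noteq> 0\<close> show False by auto
  qed
  \<comment> \<open>The factor \<open>A w\<close> inside is \<open>\<mu> v\<close> by
    \<open>Aw\<close>; pulling out \<open>\<mu>\<close> leaves \<open>B v\<close>, which is
    \<open>w\<close>.\<close>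
  moreover have "(\<Sum>h\<in>T. of_real (gram_kernel S b a (\<lambda>g x. M x g) g h) * w h) = \<mu> * w g" for g
    unfolding gram_kernel_mult by (simp add: Aw) (simp add: w_def sum_distrib_left mult_ac)
  ultimately show "\<mu> \<in> Spec T (gram_kernel S b a (\<lambda>g x. M x g))"
    by (auto simp: Spec_def)
qed

text \<open>Transposing twice restores the kernel, so the inclusion yields both directions.\<close>

lemma Spec_gram_kernel_transpose:
  "Spec S (gram_kernel T a b M) - {0} = Spec T (gram_kernel S b a (\<lambda>g x. M x g)) - {0}"
  using Spec_gram_kernel_transpose_subset[of S T a b M]
    Spec_gram_kernel_transpose_subset[of T S b a "\<lambda>g x. M x g"] by blast

lemma finite_Spec:
  assumes "finite S"
  shows "finite (Spec S P)"
proof -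
  obtain e where "bij_betw e {..<card S} S"
    using ex_bij_betw_nat_finite[OF assms] by (auto simp: lessThan_atLeast0)
  then show ?thesis
    by (simp add: Spec_eq_spectrum card_finite_spectrum(1)[OF mat_carrier])
qed

lemma Spec_cong:
  assumes "\<And>x y. x \<in> S \<Longrightarrow> y \<in> S \<Longrightarrow> P x y = P' x y"
  shows "Spec S P = Spec S P'"
  using assms by (simp add: Spec_def cong: sum.cong)

text \<open>The default for the empty set equals \<open>f 0\<close>, and a maximum over nonzero
  elements is already at least \<open>0\<close>, so the presence of \<open>0\<close> in
  \<open>A\<close> never matters.\<close>

lemma Max_image_remove_zero:
  fixes f :: "'a::zero \<Rightarrow> real"
  assumes "finite A" "\<And>x. x \<in> A \<Longrightarrow> f x \<ge> 0" "f 0 = 0"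
  shows "(if A = {} then 0 else Max (f ` A)) = (if A - {0} = {} then 0 else Max (f ` (A - {0})))"
proof (cases "A - {0} = {}")
  case True
  then consider "A = {}" | "A = {0}"
    by blast
  then show ?thesis
    by cases (simp_all add: assms(3))
next
  case False
  then have ne: "f ` (A - {0}) \<noteq> {}" "A \<noteq> {}"
    by blast+
  obtain x where x: "x \<in> A" "x \<noteq> 0"
    using False by blast
  have fin: "finite (f ` (A - {0}))"
    using assms(1) by blast
  have "Max (f ` A) = Max (f ` (A - {0}))"
  proof (cases "0 \<in> A")
    case True
    then have "f ` A = insert 0 (f ` (A - {0}))"
      using assms(3) by (metis image_insert insert_Diff)
    moreover have "0 \<le> Max (f ` (A - {0}))"
      using assms(2)[OF x(1)] Max_ge[OF fin imageI[of x "A - {0}" f]] x by simp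
    ultimately show ?thesis
      using Max_insert[OF fin ne(1), of 0] by simp
  qed simp
  then show ?thesis
    by (simp only: False ne if_False)
qed

lemma lambda_star_eq_lambda_1:
  assumes "\<And>\<mu>. \<mu> \<in> Spec S P \<Longrightarrow> \<mu> \<in> \<real> \<and> Re \<mu> \<ge> 0"
  shows "lambda_star S P = lambda_1 S P"
proof -
  have "cmod ` (Spec S P - {1}) = Re ` (Spec S P - {1})"
    using assms by (intro image_cong refl) (auto simp: in_Reals_norm complex_is_Real_iff)
  then show ?thesis
    by (simp add: lambda_star_def lambda_1_def)
qed

text \<open>Both sides reduce to the same value over the common set of eigenvalues other than
  \<open>0\<close> and \<open>1\<close>.\<close>

lemma lambda_1_cong_nonzero:
  assumes "finite (Spec S P)" "\<And>\<mu>. \<mu> \<in> Spec S P \<Longrightarrow> Re \<mu> \<ge> 0"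
    and "finite (Spec T R)" "\<And>\<mu>. \<mu> \<in> Spec T R \<Longrightarrow> Re \<mu> \<ge> 0"
    and "Spec S P - {0} = Spec T R - {0}"
  shows "lambda_1 S P = lambda_1 T R"
proof -
  have "Spec S P - {1} - {0} = Spec T R - {1} - {0}"
    using assms(5) by blast
  then show ?thesis
    unfolding lambda_1_def
    using Max_image_remove_zero[of "Spec S P - {1}" Re] Max_image_remove_zero[of "Spec T R - {1}" Re]
      assms(1-4) by simp
qed

context group_action
begin

lemma stabilizer_subset_G_star:
  assumes "x \<in> E"
  shows "stabilizer G \<phi> x \<subseteq> G_star G E \<phi>"
  using assms by (auto simp: stabilizer_def G_star_def invariants_def)

lemma card_stabilizer_pos:
  assumes "finite (carrier G)" "x \<in> E"
  shows "card (stabilizer G \<phi> x) > 0"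
  using stabilizer_one_closed[OF assms(2)] stabilizer_subset finite_subset assms(1)
  by (metis card_gt_0_iff empty_iff)

text \<open>The product of the two indicators cuts the sum over \<open>G_star\<close> down to the
  common stabilizer, which lies in \<open>G_star\<close> because its elements fix
  \<open>x\<close>.\<close>

lemma burnside_kernel_eq_gram_kernel:
  assumes "finite (carrier G)" "x \<in> E" "y \<in> E"
  shows "burnside_kernel G E \<phi> x y =
    gram_kernel (G_star G E \<phi>) (\<lambda>x. 1 / card (stabilizer G \<phi> x)) (\<lambda>g. 1 / card (invariants E \<phi> g))
      (\<lambda>x g. of_bool (\<phi> g x = x)) x y"
proof -
  have "finite (G_star G E \<phi>)"
    using assms(1) by (simp add: G_star_def)
  moreover have "stabilizer G \<phi> x \<inter> stabilizer G \<phi> y = {g \<in> G_star G E \<phi>. \<phi> g x = x \<and> \<phi> g y = y}"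
    using stabilizer_subset_G_star[OF assms(2)] by (auto simp: stabilizer_def G_star_def)
  ultimately show ?thesis
    by (auto simp: burnside_kernel_def gram_kernel_def sum.inter_filter intro!: sum.cong)
qed

lemma dual_burnside_kernel_eq_gram_kernel:
  assumes "finite E"
  shows "dual_burnside_kernel G E \<phi> g h =
    gram_kernel E (\<lambda>g. 1 / card (invariants E \<phi> g)) (\<lambda>x. 1 / card (stabilizer G \<phi> x))
      (\<lambda>g x. of_bool (\<phi> g x = x)) g h"
proof -
  have "invariants E \<phi> g \<inter> invariants E \<phi> h = {x \<in> E. \<phi> g x = x \<and> \<phi> h x = x}"
    by (auto simp: invariants_def)
  then show ?thesis
    using assms
    by (auto simp: dual_burnside_kernel_def gram_kernel_def sum.inter_filter intro!: sum.cong)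
qed

end

theorem corollary3p9:
  fixes G :: "('g, 'm) monoid_scheme"
    and X :: "'x set"
    and \<phi> :: "'g \<Rightarrow> 'x \<Rightarrow> 'x"
  defines "K \<equiv> burnside_kernel G X \<phi>"
    and "Q \<equiv> dual_burnside_kernel G X \<phi>"
    and "Gs \<equiv> G_star G X \<phi>"
  assumes "group_action G X \<phi>"
    and "finite (carrier G)"
    and "finite X"
    and "X \<noteq> {}"
  shows "(\<forall>\<mu> \<in> Spec X K. \<mu> \<in> \<real> \<and> Re \<mu> \<ge> 0) \<and>
         (\<forall>\<mu> \<in> Spec Gs Q. \<mu> \<in> \<real> \<and> Re \<mu> \<ge> 0) \<and>
         lambda_star X K = lambda_1 X K \<and>
         lambda_1 X K = lambda_1 Gs Q \<and>
         lambda_1 Gs Q = lambda_star Gs Q \<and>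
         gap X K = gap Gs Q \<and>
         t_rel X K = t_rel Gs Q"
proof -
  interpret group_action G X \<phi> by fact
  define a where "a x = 1 / real (card (stabilizer G \<phi> x))" for x
  define b where "b g = 1 / real (card (invariants X \<phi> g))" for g
  define M where "M x g = (of_bool (\<phi> g x = x) :: real)" for x g
  have finGs: "finite Gs"
    using assms(5) by (simp add: Gs_def G_star_def)
  have a: "a x > 0" if "x \<in> X" for x
    using card_stabilizer_pos[OF assms(5) that] by (simp add: a_def)
  \<comment> \<open>Restricting to \<open>Gs\<close> guarantees a fixed point, so
    \<open>|X\<^sub>g|\<close> is positive.\<close>
  have b: "b g > 0" if "g \<in> Gs" for g
    using that assms(6) by (auto simp: b_def Gs_def G_star_def invariants_def card_gt_0_iff)
  have SK: "Spec X K = Spec X (gram_kernel Gs a b M)"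
    unfolding K_def Gs_def a_def b_def M_def
    by (intro Spec_cong burnside_kernel_eq_gram_kernel assms(5))
  \<comment> \<open>The same \<open>M\<close> is transposed and the weights \<open>a\<close> and
    \<open>b\<close> trade places.\<close>
  have SQ: "Spec Gs Q = Spec Gs (gram_kernel X b a (\<lambda>g x. M x g))"
    unfolding Q_def a_def b_def M_def
    by (intro Spec_cong dual_burnside_kernel_eq_gram_kernel assms(6))
  have K: "\<mu> \<in> \<real> \<and> Re \<mu> \<ge> 0" if "\<mu> \<in> Spec X K" for \<mu>
    using Spec_gram_kernel_nonneg[of X a Gs b, OF assms(6) a less_imp_le[OF b]] that unfolding SK by blast
  have Q: "\<mu> \<in> \<real> \<and> Re \<mu> \<ge> 0" if "\<mu> \<in> Spec Gs Q" for \<mu>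
    using Spec_gram_kernel_nonneg[of Gs b X a, OF finGs b less_imp_le[OF a]] that unfolding SQ by blast
  have "lambda_1 X K = lambda_1 Gs Q"
  proof (rule lambda_1_cong_nonzero)
    show "Spec X K - {0} = Spec Gs Q - {0}"
      unfolding SK SQ by (rule Spec_gram_kernel_transpose)
  qed (use K Q finite_Spec assms(6) finGs in auto)
  moreover note lambda_star_eq_lambda_1[of X K, OF K] lambda_star_eq_lambda_1[of Gs Q, OF Q]
  ultimately show ?thesis
    using K Q by (auto simp: gap_def t_rel_def)
qed

end
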